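(* Let $\mathcal H^m$ be the Hopf algebra of matroids and, for indeterminates $x_1,x_2,y_1,y_2$, let $\alpha(x_1,x_2,y_1,y_2)=\exp_*(x_1\delta_c+x_2\delta_l)*\exp_*(y_1\delta_c+y_2\delta_l)$. Then for every matroid $M$ with ground set $E$ and rank function $r$, $$\alpha(x_1,x_2,y_1,y_2)(M)=x_1^{r(M)}\,y_2^{|E|-r(M)}\,T_M\Big(\frac{y_1}{x_1}+1,\frac{x_2}{y_2}+1\Big).$$
   Context: $\mathcal H^m$ is the free module (over a field of characteristic 0) spanned by isomorphism classes of matroids, graded by the size of the ground set, with multiplication given by direct sum, unit the empty matroid, counit $\varepsilon(M)=1$ if $M$ has empty ground set and $0$ otherwise, and coproduct $\Delta(M)=\sum_{A\subseteq E(M)}M\backslash A^c\otimes M/A$ (usual matroid deletion and contraction, $A^c=E\setminus A$). $\delta_c$ and $\delta_l$ are the linear maps with $\delta_c(U_{1,1})=1$, $\delta_l(U_{0,1})=1$, and both vanishing on every other matroid. Convolution: $f*g=m\circ(f\otimes g)\circ\Delta$; $\exp_*(\delta)=\sum_{k\ge0}\delta^{*k}/k!$ with $\delta^{*0}=\varepsilon$. The Tutte polynomial is $T_M(x,y)=\sum_{A\subseteq E}(x-1)^{r(E)-r(A)}(y-1)^{|A|-r(A)}$, and $r(M)=r(E)$. *)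

theory Defs
  imports
    "HOL-Library.Poly_Mapping"
    "HOL-Computational_Algebra.Polynomial_Factorial"
begin

section \<open>Finite matroids\<close>

definition is_matroid :: "'e set \<Rightarrow> 'e set set \<Rightarrow> bool" where
  "is_matroid E I \<longleftrightarrow>
     finite E \<and> I \<subseteq> Pow E \<and> {} \<in> I \<and>
     (\<forall>X\<in>I. \<forall>Y. Y \<subseteq> X \<longrightarrow> Y \<in> I) \<and>
     (\<forall>X\<in>I. \<forall>Y\<in>I. card X < card Y \<longrightarrow> (\<exists>y\<in>Y - X. insert y X \<in> I))"

typedef 'e matroid = "{(E :: 'e set, I). is_matroid E I}"
  by (rule exI[of _ "({}, {{}})"]) (simp add: is_matroid_def)

setup_lifting type_definition_matroid

lift_definition ground :: "'e matroid \<Rightarrow> 'e set" is fst .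

lift_definition indeps :: "'e matroid \<Rightarrow> 'e set set" is snd .

definition rank :: "'e matroid \<Rightarrow> 'e set \<Rightarrow> nat" where
  "rank M A = Max (card ` {I \<in> indeps M. I \<subseteq> A})"

lemma is_matroidI:
  assumes "finite E" "\<And>X. X \<in> I \<Longrightarrow> X \<subseteq> E" "{} \<in> I"
    "\<And>X Y. X \<in> I \<Longrightarrow> Y \<subseteq> X \<Longrightarrow> Y \<in> I"
    "\<And>X Y. X \<in> I \<Longrightarrow> Y \<in> I \<Longrightarrow> card X < card Y \<Longrightarrow> \<exists>y\<in>Y - X. insert y X \<in> I"
  shows "is_matroid E I"
  unfolding is_matroid_def using assms by (meson PowI subsetI)

lemma is_matroidD:
  assumes "is_matroid E I"
  shows "finite E" "X \<in> I \<Longrightarrow> X \<subseteq> E" "{} \<in> I" "X \<in> I \<Longrightarrow> finite X"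
    "X \<in> I \<Longrightarrow> Y \<subseteq> X \<Longrightarrow> Y \<in> I"
    "X \<in> I \<Longrightarrow> Y \<in> I \<Longrightarrow> card X < card Y \<Longrightarrow> \<exists>y\<in>Y - X. insert y X \<in> I"
proof -
  show "finite E" "{} \<in> I" using assms by (simp_all add: is_matroid_def)
  show "X \<subseteq> E" if "X \<in> I" using assms that unfolding is_matroid_def by (meson PowD subsetD)
  then show "finite X" if "X \<in> I" using \<open>finite E\<close> that by (meson finite_subset)
  show "Y \<in> I" if "X \<in> I" "Y \<subseteq> X" using assms that unfolding is_matroid_def by metis
  show "\<exists>y\<in>Y - X. insert y X \<in> I" if "X \<in> I" "Y \<in> I" "card X < card Y"
    using assms that unfolding is_matroid_def by metis
qed

lemma is_matroid_ground_indeps: "is_matroid (ground M) (indeps M)"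
  by transfer auto

lemma matroid_eqI: "ground M = ground N \<Longrightarrow> indeps M = indeps N \<Longrightarrow> M = N"
  by transfer auto

lemma finite_ground [simp]: "finite (ground M)"
  using is_matroidD(1)[OF is_matroid_ground_indeps] .

lemma indeps_subset_ground: "X \<in> indeps M \<Longrightarrow> X \<subseteq> ground M"
  using is_matroidD(2)[OF is_matroid_ground_indeps] .

lemma finite_indeps: "X \<in> indeps M \<Longrightarrow> finite X"
  using is_matroidD(4)[OF is_matroid_ground_indeps] .

lemma empty_indeps [simp]: "{} \<in> indeps M"
  using is_matroidD(3)[OF is_matroid_ground_indeps] .

lemma indeps_mono: "X \<in> indeps M \<Longrightarrow> Y \<subseteq> X \<Longrightarrow> Y \<in> indeps M"
  using is_matroidD(5)[OF is_matroid_ground_indeps] .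

lemma indeps_augment:
  "X \<in> indeps M \<Longrightarrow> Y \<in> indeps M \<Longrightarrow> card X < card Y \<Longrightarrow> \<exists>y\<in>Y - X. insert y X \<in> indeps M"
  using is_matroidD(6)[OF is_matroid_ground_indeps] .

lemma is_matroid_image:
  assumes "is_matroid E I" and inj: "inj_on f E"
  shows "is_matroid (f ` E) ((`) f ` I)"
proof -
  have E: "finite E" "I \<subseteq> Pow E" "{} \<in> I" using assms(1) by (simp_all add: is_matroid_def)
  note down = is_matroidD(5)[OF assms(1)] and aug = is_matroidD(6)[OF assms(1)]
  have crd: "card (f ` X) = card X" if "X \<in> I" for X
    using that E inj by (meson PowD card_image inj_on_subset subset_iff)
  have 1: "Y' \<in> (`) f ` I" if "X \<in> I" "Y' \<subseteq> f ` X" for X Y'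
  proof -
    obtain Z where "Z \<subseteq> X" "Y' = f ` Z" using \<open>Y' \<subseteq> f ` X\<close> by (meson subset_imageE)
    then show ?thesis using down[OF \<open>X \<in> I\<close>] by blast
  qed
  have 2: "\<exists>y\<in>f ` Y - f ` X. insert y (f ` X) \<in> (`) f ` I"
    if XY: "X \<in> I" "Y \<in> I" "card (f ` X) < card (f ` Y)" for X Y
  proof -
    obtain y where y: "y \<in> Y - X" "insert y X \<in> I"
      using aug[OF XY(1,2)] XY(3) crd XY(1,2) by auto
    have "f y \<notin> f ` X"
      using y E XY inj by (metis DiffD1 DiffD2 PowD inj_on_image_mem_iff subsetD)
    moreover have "insert (f y) (f ` X) \<in> (`) f ` I"
      using imageI[OF y(2), of "(`) f"] by simp
    ultimately show ?thesis using y by blast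
  qed
  show ?thesis
  proof (rule is_matroidI)
    fix X' Y' assume "X' \<in> (`) f ` I" "Y' \<subseteq> X'"
    then show "Y' \<in> (`) f ` I" using 1 by blast
  next
    fix X' Y' assume "X' \<in> (`) f ` I" "Y' \<in> (`) f ` I" "card X' < card Y'"
    then show "\<exists>y\<in>Y' - X'. insert y X' \<in> (`) f ` I" using 2 by blast
  next
    show "{} \<in> (`) f ` I" using imageI[OF E(3), of "(`) f"] by simp
  qed (use E in auto)
qed


section \<open>Deletion, contraction, direct sum, uniform matroids\<close>

lift_definition delete :: "'e matroid \<Rightarrow> 'e set \<Rightarrow> 'e matroid" is
  "\<lambda>(E, I) A. (E - A, {X \<in> I. X \<subseteq> E - A})"
proof (clarsimp)
  fix E :: "'e set" and I A
  assume m: "is_matroid E I"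
  show "is_matroid (E - A) {X \<in> I. X \<subseteq> E - A}"
  proof (rule is_matroidI)
    fix X Y assume *: "X \<in> {X \<in> I. X \<subseteq> E - A}" "Y \<subseteq> X"
    then show "Y \<in> {X \<in> I. X \<subseteq> E - A}" using is_matroidD(5)[OF m, of X Y] by blast
  next
    fix X Y assume *: "X \<in> {X \<in> I. X \<subseteq> E - A}" "Y \<in> {X \<in> I. X \<subseteq> E - A}" "card X < card Y"
    then obtain y where "y \<in> Y - X" "insert y X \<in> I" using is_matroidD(6)[OF m, of X Y] by blast
    then show "\<exists>y\<in>Y - X. insert y X \<in> {X \<in> I. X \<subseteq> E - A}"
      using * by (intro bexI[of _ y]) auto
  qed (use is_matroidD(1,3)[OF m] in auto)
qed

lemma ground_delete [simp]: "ground (delete M A) = ground M - A"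
  by transfer auto

lemma indeps_delete [simp]: "indeps (delete M A) = {X \<in> indeps M. X \<subseteq> ground M - A}"
  by transfer auto

definition basis_of :: "'e set set \<Rightarrow> 'e set \<Rightarrow> 'e set \<Rightarrow> bool" where
  "basis_of I A B \<longleftrightarrow> B \<in> I \<and> B \<subseteq> A \<and> (\<forall>X\<in>I. B \<subseteq> X \<and> X \<subseteq> A \<longrightarrow> X = B)"

lemma matroid_extend:
  assumes "is_matroid E I" "X \<in> I" "Y \<in> I" "card X \<le> card Y"
  shows "\<exists>Z\<in>I. X \<subseteq> Z \<and> Z \<subseteq> X \<union> Y \<and> card Z = card Y"
  using assms(2,4)
proof (induction "card Y - card X" arbitrary: X)
  case 0
  then show ?case by (intro bexI[of _ X]) auto
next
  case (Suc n)
  have fin: "finite X" using is_matroidD(4)[OF assms(1)] Suc.prems by blast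
  from Suc.hyps(2) have "card X < card Y" by simp
  then obtain y where y: "y \<in> Y - X" "insert y X \<in> I"
    using is_matroidD(6)[OF assms(1) _ assms(3)] Suc.prems by blast
  have "card (insert y X) = Suc (card X)" using y fin by simp
  then have "n = card Y - card (insert y X)" "card (insert y X) \<le> card Y"
    using Suc.hyps(2) by linarith+
  from Suc.hyps(1)[OF this(1) y(2) this(2)]
  obtain Z where "Z \<in> I" "insert y X \<subseteq> Z" "Z \<subseteq> insert y X \<union> Y" "card Z = card Y"
    by blast
  then show ?case using y by (intro bexI[of _ Z]) auto
qed

lemma basis_of_exists:
  assumes "is_matroid E I"
  shows "\<exists>B. basis_of I A B"
proof -
  let ?S = "{X \<in> I. X \<subseteq> A}"
  have "finite I" using assms unfolding is_matroid_def by (meson finite_Pow_iff finite_subset)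
  then have "finite ?S" by simp
  moreover have "{} \<in> ?S" using assms by (simp add: is_matroid_def)
  ultimately obtain B where "B \<in> ?S" "\<forall>X\<in>?S. B \<subseteq> X \<longrightarrow> B = X"
    using finite_has_maximal[of ?S] by blast
  then show ?thesis unfolding basis_of_def by (intro exI[of _ B]) auto
qed

lemma basis_of_card_le:
  assumes "is_matroid E I" "basis_of I A B" "X \<in> I" "X \<subseteq> A"
  shows "card X \<le> card B"
proof (rule ccontr)
  assume "\<not> card X \<le> card B"
  then obtain y where "y \<in> X - B" "insert y B \<in> I"
    using is_matroidD(6)[OF assms(1) _ assms(3)] assms(2) unfolding basis_of_def
    by (meson not_le)
  moreover from this have "insert y B = B"
    using assms(2,4) unfolding basis_of_def by (metis DiffD1 insert_subset subset_iff subset_insertI)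
  ultimately show False by blast
qed

lemma basis_of_exchange:
  assumes "is_matroid E I" "basis_of I A B" "basis_of I A B'" "J \<inter> A = {}" "J \<union> B \<in> I"
  shows "J \<union> B' \<in> I"
proof -
  have B: "B \<in> I" "B \<subseteq> A" "B' \<in> I" "B' \<subseteq> A" using assms(2,3) by (auto simp: basis_of_def)
  have cB: "card B = card B'"
    using basis_of_card_le[OF assms(1)] assms(2,3) B by (meson le_antisym)
  have fin: "finite (J \<union> B)" "finite B'"
    using is_matroidD(4)[OF assms(1) assms(5)] is_matroidD(4)[OF assms(1) B(3)] by simp_all
  have "card B' \<le> card (J \<union> B)" unfolding cB[symmetric] using fin(1) by (intro card_mono) auto
  then obtain Z where Z: "Z \<in> I" "B' \<subseteq> Z" "Z \<subseteq> B' \<union> (J \<union> B)" "card Z = card (J \<union> B)"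
    using matroid_extend[OF assms(1) B(3) assms(5)] by blast
  have "Z \<inter> A \<in> I" using is_matroidD(5)[OF assms(1) Z(1)] by blast
  moreover have "B' \<subseteq> Z \<inter> A" "Z \<inter> A \<subseteq> A" using Z(2) B(4) by auto
  ultimately have "Z \<inter> A = B'" using assms(3) unfolding basis_of_def by metis
  then have sub: "Z \<subseteq> J \<union> B'" using Z(3) B by blast
  have "card (J \<union> B') = card J + card B'" "card (J \<union> B) = card J + card B"
  proof -
    have "finite J" "finite B" "J \<inter> B = {}" "J \<inter> B' = {}" using fin assms(4) B by auto
    then show "card (J \<union> B') = card J + card B'" "card (J \<union> B) = card J + card B"
      using fin by (simp_all add: card_Un_disjoint)
  qed
  then have "card Z = card (J \<union> B')" using Z(4) cB by simp
  then have "Z = J \<union> B'" using sub fin by (intro card_subset_eq) auto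
  then show ?thesis using Z by simp
qed

text \<open>A set is independent in \<open>M / A\<close> if its union with a basis of \<open>A\<close> is independent in \<open>M\<close>;
  by \<open>basis_of_exchange\<close> the choice of the basis is irrelevant.\<close>

lift_definition contract :: "'e matroid \<Rightarrow> 'e set \<Rightarrow> 'e matroid" is
  "\<lambda>(E, I) A. (E - A, {J. J \<subseteq> E - A \<and> (\<exists>B. basis_of I A B \<and> J \<union> B \<in> I)})"
proof (clarsimp)
  fix E :: "'e set" and I A
  assume m: "is_matroid E I"
  obtain B where B: "basis_of I A B" using basis_of_exists[OF m] by blast
  have iff: "(J \<subseteq> E - A \<and> (\<exists>B. basis_of I A B \<and> J \<union> B \<in> I)) \<longleftrightarrow> J \<subseteq> E - A \<and> J \<union> B \<in> I" for J
    using basis_of_exchange[OF m _ B, of _ J] B by blast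
  have BI: "B \<in> I" "B \<subseteq> A" using B by (auto simp: basis_of_def)
  have fin: "finite E" "I \<subseteq> Pow E" using m by (auto simp: is_matroid_def)
  note down = is_matroidD(5)[OF m] and aug = is_matroidD(6)[OF m]
  have crd: "card (J \<union> B) = card J + card B" if "J \<subseteq> E - A" for J
  proof (rule card_Un_disjoint)
    show "finite J" using that fin(1) by (meson finite_Diff finite_subset)
    show "finite B" using is_matroidD(4)[OF m BI(1)] .
  qed (use that BI in auto)
  show "is_matroid (E - A) {J. J \<subseteq> E - A \<and> (\<exists>B. basis_of I A B \<and> J \<union> B \<in> I)}"
    unfolding iff
  proof (rule is_matroidI, goal_cases)
    case (4 X Y)
    then show ?case using down[of "X \<union> B" "Y \<union> B"] by blast
  next
    case (5 X Y)
    then have "card (X \<union> B) < card (Y \<union> B)" using crd by auto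
    then obtain y where "y \<in> (Y \<union> B) - (X \<union> B)" "insert y (X \<union> B) \<in> I"
      using aug[of "X \<union> B" "Y \<union> B"] 5 by blast
    then show ?case using 5 by (intro bexI[of _ y]) auto
  qed (use fin BI in auto)
qed

lemma ground_contract [simp]: "ground (contract M A) = ground M - A"
  by transfer auto

lemma indeps_contract:
  "indeps (contract M A) =
     {J. J \<subseteq> ground M - A \<and> (\<exists>B. basis_of (indeps M) A B \<and> J \<union> B \<in> indeps M)}"
  by transfer auto

lemma vimage_Inl_Plus: "Inl -` (X <+> Y) = X" and vimage_Inr_Plus: "Inr -` (X <+> Y) = Y"
  by auto

lemma Plus_vimage: "(Inl -` Z) <+> (Inr -` Z) = Z"
  by (auto simp: Plus_def vimage_def image_iff) (metis sum.exhaust)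

lift_definition direct_sum :: "'a matroid \<Rightarrow> 'b matroid \<Rightarrow> ('a + 'b) matroid" is
  "\<lambda>(E, I) (F, J). (E <+> F, {X <+> Y |X Y. X \<in> I \<and> Y \<in> J})"
proof (clarsimp)
  fix E :: "'a set" and I and F :: "'b set" and J
  assume m: "is_matroid E I" "is_matroid F J"
  have E: "finite E" "I \<subseteq> Pow E" "{} \<in> I" "finite F" "J \<subseteq> Pow F" "{} \<in> J"
    using m by (auto simp: is_matroid_def)
  note down = is_matroidD(5)[OF m(1)] is_matroidD(5)[OF m(2)]
  note aug = is_matroidD(6)[OF m(1)] is_matroidD(6)[OF m(2)]
  note fin = is_matroidD(4)[OF m(1)] is_matroidD(4)[OF m(2)]
  let ?S = "{X <+> Y |X Y. X \<in> I \<and> Y \<in> J}"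
  have 1: "Z \<in> ?S" if "X \<in> I" "Y \<in> J" "Z \<subseteq> X <+> Y" for X Y Z
  proof -
    have "Z = (Inl -` Z) <+> (Inr -` Z)"
      by (simp add: Plus_vimage)
    moreover have "Inl -` Z \<subseteq> X" "Inr -` Z \<subseteq> Y" using that(3) by auto
    moreover have "Inl -` Z \<in> I" "Inr -` Z \<in> J"
      using down that(1,2) calculation(2,3) by auto
    ultimately show ?thesis by blast
  qed
  have 2: "\<exists>z\<in>(X' <+> Y') - (X <+> Y). insert z (X <+> Y) \<in> ?S"
    if XY: "X \<in> I" "Y \<in> J" "X' \<in> I" "Y' \<in> J" "card (X <+> Y) < card (X' <+> Y')" for X Y X' Y'
  proof -
    have "card X + card Y < card X' + card Y'" using XY fin by (simp add: card_Plus)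
    then consider "card X < card X'" | "card Y < card Y'" by linarith
    then show ?thesis
    proof cases
      case 1
      then obtain y where y: "y \<in> X' - X" "insert y X \<in> I" using aug XY by blast
      have "insert (Inl y) (X <+> Y) = insert y X <+> Y" by auto
      then show ?thesis using y XY by (intro bexI[of _ "Inl y"]) auto
    next
      case 2
      then obtain y where y: "y \<in> Y' - Y" "insert y Y \<in> J" using aug XY by blast
      have "insert (Inr y) (X <+> Y) = X <+> insert y Y" by auto
      then show ?thesis using y XY by (intro bexI[of _ "Inr y"]) auto
    qed
  qed
  have 3: "{} \<in> ?S" using E by (auto intro!: exI[of _ "{}"])
  have 4: "?S \<subseteq> Pow (E <+> F)" using E by blast
  show "is_matroid (E <+> F) ?S"
  proof (rule is_matroidI)
    fix X Y assume "X \<in> ?S" "Y \<subseteq> X" then show "Y \<in> ?S" using 1 by blast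
  next
    fix X Y assume "X \<in> ?S" "Y \<in> ?S" "card X < card Y"
    then show "\<exists>y\<in>Y - X. insert y X \<in> ?S" using 2 by blast
  qed (use E 3 4 in auto)
qed

lemma ground_direct_sum [simp]: "ground (direct_sum M N) = ground M <+> ground N"
  by transfer auto

lemma indeps_direct_sum:
  "indeps (direct_sum M N) = {X <+> Y |X Y. X \<in> indeps M \<and> Y \<in> indeps N}"
  by (simp add: indeps.rep_eq direct_sum.rep_eq split: prod.splits)

lift_definition uniform :: "nat \<Rightarrow> nat \<Rightarrow> nat matroid" is
  "\<lambda>r n. ({..<n}, {X. X \<subseteq> {..<n} \<and> card X \<le> r})"
proof (clarsimp)
  fix r n :: nat
  have fin: "finite X" if "X \<subseteq> {..<n}" for X using finite_subset[OF that] by simp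
  show "is_matroid {..<n} {X. X \<subseteq> {..<n} \<and> card X \<le> r}"
  proof (rule is_matroidI)
    fix X Y assume *: "X \<in> {X. X \<subseteq> {..<n} \<and> card X \<le> r}" "Y \<subseteq> X"
    then have "X \<subseteq> {..<n}" "card X \<le> r" by simp_all
    then show "Y \<in> {X. X \<subseteq> {..<n} \<and> card X \<le> r}"
      using *(2) card_mono[OF fin[of X] *(2)] by auto
  next
    fix X Y
    assume "X \<in> {X. X \<subseteq> {..<n} \<and> card X \<le> r}" "Y \<in> {X. X \<subseteq> {..<n} \<and> card X \<le> r}"
      and less: "card X < card Y"
    then have X: "X \<subseteq> {..<n}" and Y: "Y \<subseteq> {..<n}" "card Y \<le> r" by simp_all
    have "\<not> Y \<subseteq> X" using card_mono[OF fin[OF X], of Y] less by linarith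
    then obtain y where y: "y \<in> Y" "y \<notin> X" by blast
    have "card (insert y X) \<le> r" using y fin[OF X] less Y by simp
    then show "\<exists>y\<in>Y - X. insert y X \<in> {X. X \<subseteq> {..<n} \<and> card X \<le> r}"
      using y X Y by (intro bexI[of _ y]) auto
  qed auto
qed

lemma ground_uniform [simp]: "ground (uniform r n) = {..<n}"
  by transfer simp

lemma indeps_uniform [simp]: "indeps (uniform r n) = {X. X \<subseteq> {..<n} \<and> card X \<le> r}"
  by transfer simp


section \<open>Isomorphism classes\<close>

definition matroid_iso :: "'a matroid \<Rightarrow> 'b matroid \<Rightarrow> bool" (infix \<open>\<cong>\<^sub>M\<close> 50) where
  "M \<cong>\<^sub>M N \<longleftrightarrow> (\<exists>f. bij_betw f (ground M) (ground N) \<and>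
     (\<forall>X. X \<subseteq> ground M \<longrightarrow> (X \<in> indeps M \<longleftrightarrow> f ` X \<in> indeps N)))"

lemma matroid_isoI:
  assumes "inj_on f (ground M)" "ground N = f ` ground M" "indeps N = (`) f ` indeps M"
  shows "M \<cong>\<^sub>M N"
proof -
  have "X \<in> indeps M" if "X \<subseteq> ground M" "f ` X = f ` Y" "Y \<in> indeps M" for X Y
    using inj_on_image_eq_iff[OF assms(1) that(1) indeps_subset_ground[OF that(3)]] that by simp
  then have "X \<in> indeps M \<longleftrightarrow> f ` X \<in> indeps N" if "X \<subseteq> ground M" for X
    using that assms(3) by (metis image_iff)
  then show ?thesis
    using assms(1,2) unfolding matroid_iso_def bij_betw_def by blast
qed

lemma matroid_iso_refl: "M \<cong>\<^sub>M M"
  unfolding matroid_iso_def by (intro exI[of _ id]) (auto simp: bij_betw_def)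

lemma matroid_iso_sym:
  assumes "M \<cong>\<^sub>M N" shows "N \<cong>\<^sub>M M"
proof -
  obtain f where f: "bij_betw f (ground M) (ground N)"
    "\<And>X. X \<subseteq> ground M \<Longrightarrow> X \<in> indeps M \<longleftrightarrow> f ` X \<in> indeps N"
    using assms unfolding matroid_iso_def by blast
  let ?g = "inv_into (ground M) f"
  have g: "bij_betw ?g (ground N) (ground M)" using f(1) by (rule bij_betw_inv_into)
  have "X \<in> indeps N \<longleftrightarrow> ?g ` X \<in> indeps M" if "X \<subseteq> ground N" for X
  proof -
    have "?g ` X \<subseteq> ground M" using g that by (auto simp: bij_betw_def)
    moreover have "f ` ?g ` X = X" using f(1) that
      by (simp add: bij_betw_def image_inv_into_cancel)
    ultimately show ?thesis using f(2) by metis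
  qed
  then show ?thesis using g unfolding matroid_iso_def by blast
qed

lemma matroid_iso_trans:
  assumes "M \<cong>\<^sub>M N" "N \<cong>\<^sub>M P" shows "M \<cong>\<^sub>M P"
proof -
  obtain f where f: "bij_betw f (ground M) (ground N)"
    "\<And>X. X \<subseteq> ground M \<Longrightarrow> X \<in> indeps M \<longleftrightarrow> f ` X \<in> indeps N"
    using assms unfolding matroid_iso_def by blast
  obtain g where g: "bij_betw g (ground N) (ground P)"
    "\<And>X. X \<subseteq> ground N \<Longrightarrow> X \<in> indeps N \<longleftrightarrow> g ` X \<in> indeps P"
    using assms unfolding matroid_iso_def by blast
  have "X \<in> indeps M \<longleftrightarrow> (g \<circ> f) ` X \<in> indeps P" if "X \<subseteq> ground M" for X
  proof -
    have "f ` X \<subseteq> ground N" using f(1) that by (auto simp: bij_betw_def)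
    then show ?thesis using f(2)[OF that] g(2) by (simp add: image_comp)
  qed
  then show ?thesis using bij_betw_trans[OF f(1) g(1)] unfolding matroid_iso_def by blast
qed

text \<open>Every finite matroid is isomorphic to one whose elements are natural numbers, so the
  isomorphism classes of all finite matroids form the following type.\<close>

quotient_type matroid_class = "nat matroid" / "matroid_iso"
  by (intro equivpI reflpI sympI transpI)
     (blast intro: matroid_iso_refl matroid_iso_sym matroid_iso_trans)+

definition class_of :: "'e matroid \<Rightarrow> matroid_class" where
  "class_of M = abs_matroid_class (SOME N. M \<cong>\<^sub>M N)"

lemma matroid_iso_nat_exists: "\<exists>N :: nat matroid. M \<cong>\<^sub>M N"
proof -
  obtain f :: "'a \<Rightarrow> nat" where f: "inj_on f (ground M)"
    using finite_ground[of M] finite_imp_inj_to_nat_seg by blast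
  define N where "N = Abs_matroid (f ` ground M, (`) f ` indeps M)"
  have "Rep_matroid N = (f ` ground M, (`) f ` indeps M)"
    unfolding N_def
    by (rule Abs_matroid_inverse) (simp add: is_matroid_image[OF is_matroid_ground_indeps f])
  then have N: "ground N = f ` ground M" "indeps N = (`) f ` indeps M"
    by (simp_all add: ground.rep_eq indeps.rep_eq)
  then show ?thesis using matroid_isoI[OF f] by blast
qed

lemma class_of_nat: "class_of M = abs_matroid_class M"
  unfolding class_of_def
  by (metis (mono_tags, lifting) matroid_iso_refl matroid_class.abs_eq_iff someI matroid_iso_sym)

lemma class_of_eq_iff: "class_of M = class_of N \<longleftrightarrow> M \<cong>\<^sub>M N"
proof -
  have M: "M \<cong>\<^sub>M (SOME M'. M \<cong>\<^sub>M (M' :: nat matroid))"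
    using matroid_iso_nat_exists by (rule someI_ex)
  have N: "N \<cong>\<^sub>M (SOME N'. N \<cong>\<^sub>M (N' :: nat matroid))"
    using matroid_iso_nat_exists by (rule someI_ex)
  show ?thesis
    unfolding class_of_def matroid_class.abs_eq_iff
    using matroid_iso_trans[OF matroid_iso_trans[OF M] matroid_iso_sym[OF N]]
      matroid_iso_trans[OF matroid_iso_trans[OF matroid_iso_sym[OF M]] N] by blast
qed

lemma class_of_rep: "class_of (rep_matroid_class c) = c"
  unfolding class_of_nat using Quotient_matroid_class by (rule Quotient_abs_rep)

lemma rep_class_of: "rep_matroid_class (class_of M) \<cong>\<^sub>M M"
  by (metis class_of_eq_iff class_of_rep)

lemma direct_sum_cong:
  assumes "M \<cong>\<^sub>M M'" "N \<cong>\<^sub>M N'" shows "direct_sum M N \<cong>\<^sub>M direct_sum M' N'"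
proof -
  obtain f where f: "bij_betw f (ground M) (ground M')"
    "\<And>X. X \<subseteq> ground M \<Longrightarrow> X \<in> indeps M \<longleftrightarrow> f ` X \<in> indeps M'"
    using assms unfolding matroid_iso_def by blast
  obtain g where g: "bij_betw g (ground N) (ground N')"
    "\<And>X. X \<subseteq> ground N \<Longrightarrow> X \<in> indeps N \<longleftrightarrow> g ` X \<in> indeps N'"
    using assms unfolding matroid_iso_def by blast
  let ?h = "map_sum f g"
  have img: "?h ` (X <+> Y) = f ` X <+> g ` Y" for X Y
    by (auto simp: Plus_def image_Un image_image)
  have h: "bij_betw ?h (ground M <+> ground N) (ground M' <+> ground N')"
  proof -
    have "inj_on f (ground M)" "inj_on g (ground N)"
      and im: "f ` ground M = ground M'" "g ` ground N = ground N'"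
      using f(1) g(1) by (simp_all add: bij_betw_def)
    have "inj_on ?h (ground M <+> ground N)"
    proof (rule inj_onI)
      fix x y assume "x \<in> ground M <+> ground N" "y \<in> ground M <+> ground N" "?h x = ?h y"
      then show "x = y"
        using inj_onD[OF \<open>inj_on f (ground M)\<close>] inj_onD[OF \<open>inj_on g (ground N)\<close>]
        by (cases x; cases y) auto
    qed
    then show ?thesis by (simp add: bij_betw_def img im)
  qed
  have ds: "X <+> Y \<in> indeps (direct_sum P Q) \<longleftrightarrow> X \<in> indeps P \<and> Y \<in> indeps Q" for X Y P Q
    unfolding indeps_direct_sum mem_Collect_eq by (metis vimage_Inl_Plus vimage_Inr_Plus)
  have "Z \<in> indeps (direct_sum M N) \<longleftrightarrow> ?h ` Z \<in> indeps (direct_sum M' N')"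
    if "Z \<subseteq> ground M <+> ground N" for Z
  proof -
    have "Inl -` Z \<subseteq> ground M" "Inr -` Z \<subseteq> ground N" using that by auto
    then have "(Inl -` Z) <+> (Inr -` Z) \<in> indeps (direct_sum M N) \<longleftrightarrow>
        ?h ` ((Inl -` Z) <+> (Inr -` Z)) \<in> indeps (direct_sum M' N')"
      by (simp only: img ds f(2) g(2))
    then show ?thesis by (simp only: Plus_vimage)
  qed
  then show ?thesis using h unfolding matroid_iso_def by auto
qed


lemma iso_basis_of:
  assumes f: "inj_on f (ground M)"
    "\<And>X. X \<subseteq> ground M \<Longrightarrow> X \<in> indeps M \<longleftrightarrow> f ` X \<in> indeps N"
    and A: "A \<subseteq> ground M" "B \<subseteq> A"
  shows "basis_of (indeps M) A B \<longleftrightarrow> basis_of (indeps N) (f ` A) (f ` B)"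
proof -
  have eq: "f ` X = f ` Y \<longleftrightarrow> X = Y" if "X \<subseteq> A" "Y \<subseteq> A" for X Y
    using inj_on_image_eq_iff[OF f(1)] that A by (meson subset_trans)
  have le: "f ` X \<subseteq> f ` Y \<longleftrightarrow> X \<subseteq> Y" if "X \<subseteq> A" "Y \<subseteq> A" for X Y
  proof
    assume *: "f ` X \<subseteq> f ` Y"
    show "X \<subseteq> Y"
    proof
      fix x assume "x \<in> X"
      then obtain y where "y \<in> Y" "f x = f y" using * by blast
      moreover have "x \<in> ground M" "y \<in> ground M" using \<open>x \<in> X\<close> \<open>y \<in> Y\<close> that A by auto
      ultimately show "x \<in> Y" using inj_onD[OF f(1)] by metis
    qed
  qed (rule image_mono)
  have mem: "X \<in> indeps M \<longleftrightarrow> f ` X \<in> indeps N" if "X \<subseteq> A" for X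
    using f(2) that A by (meson subset_trans)
  have "(\<forall>X. X \<in> indeps M \<longrightarrow> B \<subseteq> X \<and> X \<subseteq> A \<longrightarrow> X = B) \<longleftrightarrow>
        (\<forall>X. X \<subseteq> A \<longrightarrow> f ` X \<in> indeps N \<longrightarrow> f ` B \<subseteq> f ` X \<longrightarrow> f ` X = f ` B)"
  proof (rule iff_allI)
    fix X
    show "(X \<in> indeps M \<longrightarrow> B \<subseteq> X \<and> X \<subseteq> A \<longrightarrow> X = B) \<longleftrightarrow>
      (X \<subseteq> A \<longrightarrow> f ` X \<in> indeps N \<longrightarrow> f ` B \<subseteq> f ` X \<longrightarrow> f ` X = f ` B)"
      using eq[OF _ A(2), of X] le[OF A(2), of X] mem[of X] by blast
  qed
  also have "\<dots> \<longleftrightarrow> (\<forall>X\<in>indeps N. f ` B \<subseteq> X \<and> X \<subseteq> f ` A \<longrightarrow> X = f ` B)"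
    by (metis image_mono subset_imageE)
  finally show ?thesis
    using mem[OF A(2)] A(2) image_mono[OF A(2), of f] unfolding basis_of_def Ball_def
    by (simp only: simp_thms)
qed

lemma iso_contract:
  assumes f: "bij_betw f (ground M) (ground N)"
    "\<And>X. X \<subseteq> ground M \<Longrightarrow> X \<in> indeps M \<longleftrightarrow> f ` X \<in> indeps N"
    and A: "A \<subseteq> ground M"
  shows "contract M A \<cong>\<^sub>M contract N (f ` A)"
proof -
  have inj: "inj_on f (ground M)" and im: "f ` ground M = ground N"
    using f(1) by (auto simp: bij_betw_def)
  have im': "f ` (ground M - A) = ground N - f ` A"
    using inj_on_image_set_diff[OF inj, of "ground M" A] A im by simp
  have iff: "J \<in> indeps (contract M A) \<longleftrightarrow> f ` J \<in> indeps (contract N (f ` A))"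
    if J: "J \<subseteq> ground M - A" for J
  proof -
    have "(\<exists>B. basis_of (indeps M) A B \<and> J \<union> B \<in> indeps M) \<longleftrightarrow>
        (\<exists>B\<subseteq>A. basis_of (indeps M) A B \<and> J \<union> B \<in> indeps M)"
      by (auto simp: basis_of_def)
    also have "\<dots> \<longleftrightarrow> (\<exists>B\<subseteq>A. basis_of (indeps N) (f ` A) (f ` B) \<and> f ` J \<union> f ` B \<in> indeps N)"
    proof -
      have "J \<union> B \<in> indeps M \<longleftrightarrow> f ` J \<union> f ` B \<in> indeps N" if "B \<subseteq> A" for B
        using f(2)[of "J \<union> B"] J A that by (simp add: image_Un) blast
      then show ?thesis using iso_basis_of[OF inj f(2) A] by blast
    qed
    also have "\<dots> \<longleftrightarrow> (\<exists>B. basis_of (indeps N) (f ` A) B \<and> f ` J \<union> B \<in> indeps N)"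
    proof
      assume "\<exists>B. basis_of (indeps N) (f ` A) B \<and> f ` J \<union> B \<in> indeps N"
      then obtain B' where B': "basis_of (indeps N) (f ` A) B'" "f ` J \<union> B' \<in> indeps N"
        by blast
      then have "B' \<subseteq> f ` A" by (simp add: basis_of_def)
      then obtain B where "B \<subseteq> A" "B' = f ` B" by (rule subset_imageE)
      then show "\<exists>B\<subseteq>A. basis_of (indeps N) (f ` A) (f ` B) \<and> f ` J \<union> f ` B \<in> indeps N"
        using B' by blast
    qed blast
    finally show ?thesis
      using J im' by (auto simp: indeps_contract)
  qed
  have "bij_betw f (ground M - A) (ground N - f ` A)"
    using inj im' inj_on_subset[OF inj, of "ground M - A"] by (auto simp: bij_betw_def)
  then show ?thesis using iff unfolding matroid_iso_def by (intro exI[of _ f]) auto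
qed

lemma iso_delete:
  assumes f: "bij_betw f (ground M) (ground N)"
    "\<And>X. X \<subseteq> ground M \<Longrightarrow> X \<in> indeps M \<longleftrightarrow> f ` X \<in> indeps N"
    and A: "A \<subseteq> ground M"
  shows "delete M A \<cong>\<^sub>M delete N (f ` A)"
proof -
  have inj: "inj_on f (ground M)" and im: "f ` ground M = ground N"
    using f(1) by (auto simp: bij_betw_def)
  have im': "f ` (ground M - A) = ground N - f ` A"
    using inj_on_image_set_diff[OF inj, of "ground M" A] A im by simp
  have "bij_betw f (ground M - A) (ground N - f ` A)"
    using inj im' inj_on_subset[OF inj, of "ground M - A"] by (auto simp: bij_betw_def)
  moreover have "X \<in> indeps M \<longleftrightarrow> f ` X \<in> indeps N" "f ` X \<subseteq> ground N - f ` A"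
    if "X \<subseteq> ground M - A" for X
    using f(2)[of X] that im' by auto
  ultimately show ?thesis unfolding matroid_iso_def by (intro exI[of _ f]) auto
qed

instantiation matroid_class :: comm_monoid_add
begin

definition zero_matroid_class :: matroid_class where
  "0 = class_of (uniform 0 0)"

definition plus_matroid_class :: "matroid_class \<Rightarrow> matroid_class \<Rightarrow> matroid_class" where
  "c + d = class_of (direct_sum (rep_matroid_class c) (rep_matroid_class d))"

lemma class_of_direct_sum: "class_of (direct_sum M N) = class_of M + class_of N"
  unfolding plus_matroid_class_def class_of_eq_iff
  by (intro direct_sum_cong matroid_iso_sym[OF rep_class_of])

instance
proof
  fix a b c :: matroid_class
  obtain M N P :: "nat matroid" where [simp]: "a = class_of M" "b = class_of N" "c = class_of P"
    by (metis class_of_rep)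
  let ?h = "case_sum (case_sum Inl (Inr \<circ> Inl)) (Inr \<circ> Inr) :: (nat + nat) + nat \<Rightarrow> nat + (nat + nat)"
  have h: "?h ` ((X <+> Y) <+> Z) = X <+> (Y <+> Z)" for X Y Z
    by (auto simp: Plus_def image_Un image_image)
  have "direct_sum (direct_sum M N) P \<cong>\<^sub>M direct_sum M (direct_sum N P)"
  proof (rule matroid_isoI)
    show "inj_on ?h (ground (direct_sum (direct_sum M N) P))"
      by (auto simp: inj_on_def split: sum.splits)
    show "ground (direct_sum M (direct_sum N P)) = ?h ` ground (direct_sum (direct_sum M N) P)"
      by (simp add: h)
    show "indeps (direct_sum M (direct_sum N P)) = (`) ?h ` indeps (direct_sum (direct_sum M N) P)"
    proof (intro subset_antisym subsetI)
      fix W assume "W \<in> indeps (direct_sum M (direct_sum N P))"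
      then obtain X Y Z where *: "X \<in> indeps M" "Y \<in> indeps N" "Z \<in> indeps P"
          and W: "W = X <+> (Y <+> Z)"
        unfolding indeps_direct_sum by blast
      have "(X <+> Y) <+> Z \<in> indeps (direct_sum (direct_sum M N) P)"
        using * unfolding indeps_direct_sum by blast
      then show "W \<in> (`) ?h ` indeps (direct_sum (direct_sum M N) P)"
        unfolding W by (rule image_eqI[rotated]) (rule h[symmetric])
    next
      fix W assume "W \<in> (`) ?h ` indeps (direct_sum (direct_sum M N) P)"
      then obtain V where V: "W = ?h ` V" "V \<in> indeps (direct_sum (direct_sum M N) P)"
        by (rule imageE)
      then obtain X Y Z where *: "X \<in> indeps M" "Y \<in> indeps N" "Z \<in> indeps P"
          and VV: "V = (X <+> Y) <+> Z"
        unfolding indeps_direct_sum by blast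
      show "W \<in> indeps (direct_sum M (direct_sum N P))"
        unfolding V(1) VV h using * unfolding indeps_direct_sum by blast
    qed
  qed
  then show "a + b + c = a + (b + c)"
    by (simp add: class_of_direct_sum[symmetric] class_of_eq_iff)
  let ?s = "case_sum Inr Inl :: nat + nat \<Rightarrow> nat + nat"
  have s: "?s ` (X <+> Y) = Y <+> X" for X Y
    by (auto simp: Plus_def image_Un image_image)
  have "direct_sum M N \<cong>\<^sub>M direct_sum N M"
  proof (rule matroid_isoI)
    show "inj_on ?s (ground (direct_sum M N))"
      by (auto simp: inj_on_def split: sum.splits)
    show "ground (direct_sum N M) = ?s ` ground (direct_sum M N)"
      by (simp add: s)
    show "indeps (direct_sum N M) = (`) ?s ` indeps (direct_sum M N)"
    proof (intro subset_antisym subsetI)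
      fix W assume "W \<in> indeps (direct_sum N M)"
      then obtain X Y where *: "X \<in> indeps M" "Y \<in> indeps N" and W: "W = Y <+> X"
        unfolding indeps_direct_sum by blast
      have "X <+> Y \<in> indeps (direct_sum M N)"
        using * unfolding indeps_direct_sum by blast
      then show "W \<in> (`) ?s ` indeps (direct_sum M N)"
        unfolding W by (rule image_eqI[rotated]) (rule s[symmetric])
    next
      fix W assume "W \<in> (`) ?s ` indeps (direct_sum M N)"
      then obtain V where V: "W = ?s ` V" "V \<in> indeps (direct_sum M N)"
        by (rule imageE)
      then obtain X Y where *: "X \<in> indeps M" "Y \<in> indeps N" and VV: "V = X <+> Y"
        unfolding indeps_direct_sum by blast
      show "W \<in> indeps (direct_sum N M)"
        unfolding V(1) VV s using * unfolding indeps_direct_sum by blast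
    qed
  qed
  then show "a + b = b + a"
    by (simp add: class_of_direct_sum[symmetric] class_of_eq_iff)
  let ?e = "Inr :: nat \<Rightarrow> nat + nat"
  have e: "?e ` X = {} <+> X" for X
    by (auto simp: Plus_def)
  have "M \<cong>\<^sub>M direct_sum (uniform 0 0) M"
  proof (rule matroid_isoI)
    show "inj_on ?e (ground M)" by simp
    show "ground (direct_sum (uniform 0 0) M) = ?e ` ground M" by (simp add: e)
    have "indeps (uniform 0 0) = {{}}" by auto
    then have "indeps (direct_sum (uniform 0 0) M) = {{} <+> Y |Y. Y \<in> indeps M}"
      unfolding indeps_direct_sum by blast
    also have "\<dots> = (\<lambda>Y. {} <+> Y) ` indeps M" by blast
    also have "\<dots> = (`) ?e ` indeps M" by (rule image_cong) (simp_all only: e)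
    finally show "indeps (direct_sum (uniform 0 0) M) = (`) ?e ` indeps M" .
  qed
  then show "0 + a = a"
    by (simp add: zero_matroid_class_def class_of_direct_sum[symmetric] class_of_eq_iff
        matroid_iso_sym)
qed

end


section \<open>The Hopf algebra of matroids\<close>

text \<open>The free module on the isomorphism classes. Addition of classes is direct sum and the zero
  class is that of the empty matroid, so the library multiplication of \<open>\<Rightarrow>\<^sub>0\<close> is the bilinear
  extension of the direct sum, with unit the empty matroid.\<close>

type_synonym 'k matroid_hopf = "matroid_class \<Rightarrow>\<^sub>0 'k"

text \<open>The tensor square, as the free module on pairs of classes; the pair \<open>(c, d)\<close> stands for
  \<open>c \<otimes> d\<close>.\<close>

type_synonym 'k matroid_hopf2 = "(matroid_class \<times> matroid_class) \<Rightarrow>\<^sub>0 'k"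

definition matroid_elem :: "'e matroid \<Rightarrow> 'k::zero_neq_one matroid_hopf" where
  "matroid_elem M = Poly_Mapping.single (class_of M) 1"

lemma matroid_elem_direct_sum:
  "(matroid_elem (direct_sum M N) :: 'k::comm_ring_1 matroid_hopf) = matroid_elem M * matroid_elem N"
  by (simp add: matroid_elem_def class_of_direct_sum mult_single)

text \<open>The linear extension to the free module on \<open>'b\<close> of a map \<open>\<phi>\<close> from \<open>'b\<close> to a module
  with scalar multiplication \<open>s\<close>.\<close>

definition lin_ext ::
    "('k::zero \<Rightarrow> 'm \<Rightarrow> 'm) \<Rightarrow> ('b \<Rightarrow> 'm) \<Rightarrow> ('b \<Rightarrow>\<^sub>0 'k) \<Rightarrow> 'm::comm_monoid_add" where
  "lin_ext s \<phi> h = (\<Sum>b\<in>Poly_Mapping.keys h. s (Poly_Mapping.lookup h b) (\<phi> b))"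

definition free_scale :: "'k::comm_ring_1 \<Rightarrow> ('b \<Rightarrow>\<^sub>0 'k) \<Rightarrow> ('b \<Rightarrow>\<^sub>0 'k)" where
  "free_scale a = Poly_Mapping.map ((*) a)"

definition coproduct_matroid :: "'e matroid \<Rightarrow> 'k::comm_ring_1 matroid_hopf2" where
  "coproduct_matroid M = (\<Sum>A\<in>Pow (ground M).
     Poly_Mapping.single (class_of (delete M (ground M - A)), class_of (contract M A)) 1)"

definition coproduct :: "'k::comm_ring_1 matroid_hopf \<Rightarrow> 'k matroid_hopf2" where
  "coproduct = lin_ext free_scale (\<lambda>c. coproduct_matroid (rep_matroid_class c))"

lemma coproduct_matroid_cong:
  assumes "M \<cong>\<^sub>M N"
  shows "(coproduct_matroid M :: 'k::comm_ring_1 matroid_hopf2) = coproduct_matroid N"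
proof -
  obtain f where f: "bij_betw f (ground M) (ground N)"
    "\<And>X. X \<subseteq> ground M \<Longrightarrow> X \<in> indeps M \<longleftrightarrow> f ` X \<in> indeps N"
    using assms unfolding matroid_iso_def by blast
  have inj: "inj_on f (ground M)" and im: "f ` ground M = ground N"
    using f(1) by (auto simp: bij_betw_def)
  have "(coproduct_matroid N :: 'k matroid_hopf2) = (\<Sum>A\<in>Pow (ground M).
     Poly_Mapping.single (class_of (delete N (ground N - f ` A)), class_of (contract N (f ` A))) 1)"
    unfolding coproduct_matroid_def
    by (rule sum.reindex_bij_betw[OF bij_betw_Pow[OF f(1)], symmetric])
  also have "\<dots> = coproduct_matroid M"
    unfolding coproduct_matroid_def
  proof (rule sum.cong[OF refl])
    fix A assume A: "A \<in> Pow (ground M)"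
    have "f ` (ground M - A) = ground N - f ` A"
      using inj_on_image_set_diff[OF inj, of "ground M" A] A im by simp
    then have "delete M (ground M - A) \<cong>\<^sub>M delete N (ground N - f ` A)"
      using iso_delete[OF f, of "ground M - A"] by simp
    moreover have "contract M A \<cong>\<^sub>M contract N (f ` A)" using iso_contract[OF f] A by blast
    ultimately show "Poly_Mapping.single
        (class_of (delete N (ground N - f ` A)), class_of (contract N (f ` A))) 1 =
      Poly_Mapping.single (class_of (delete M (ground M - A)), class_of (contract M A)) (1::'k)"
      by (metis class_of_eq_iff)
  qed
  finally show ?thesis ..
qed

lemma coproduct_matroid_elem: "coproduct (matroid_elem M) = coproduct_matroid M"
proof -
  have "free_scale 1 h = h" for h :: "'k::comm_ring_1 matroid_hopf2"
    by (rule poly_mapping_eqI) (simp add: free_scale_def map.rep_eq when_def)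
  then show ?thesis
    by (simp add: coproduct_def lin_ext_def matroid_elem_def
        coproduct_matroid_cong[OF rep_class_of])
qed


section \<open>Linear maps into the rational functions and their convolution\<close>

text \<open>The field \<open>k(x\<^sub>1, x\<^sub>2, y\<^sub>1, y\<^sub>2)\<close>, as the fraction field of the iterated polynomial ring
  \<open>k[x\<^sub>1][x\<^sub>2][y\<^sub>1][y\<^sub>2]\<close>; the innermost polynomial layer belongs to \<open>x\<^sub>1\<close>.\<close>

type_synonym 'k ratfun = "'k poly poly poly poly fract"

definition const :: "'k::field \<Rightarrow> 'k ratfun" where
  "const a = to_fract [:[:[:[:a:]:]:]:]"

definition X1 :: "'k::field ratfun" where "X1 = to_fract [:[:[:[:0, 1:]:]:]:]"
definition X2 :: "'k::field ratfun" where "X2 = to_fract [:[:[:0, 1:]:]:]"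
definition Y1 :: "'k::field ratfun" where "Y1 = to_fract [:[:0, 1:]:]"
definition Y2 :: "'k::field ratfun" where "Y2 = to_fract [:0, 1:]"

definition lin :: "('b \<Rightarrow> 'k::field ratfun) \<Rightarrow> ('b \<Rightarrow>\<^sub>0 'k) \<Rightarrow> 'k ratfun" where
  "lin = lin_ext (\<lambda>a z. const a * z)"

definition counit :: "'k::field matroid_hopf \<Rightarrow> 'k ratfun" where
  "counit = lin (\<lambda>c. if ground (rep_matroid_class c) = {} then 1 else 0)"

definition delta_coloop :: "'k::field matroid_hopf \<Rightarrow> 'k ratfun" where
  "delta_coloop = lin (\<lambda>c. if c = class_of (uniform 1 1) then 1 else 0)"

definition delta_loop :: "'k::field matroid_hopf \<Rightarrow> 'k ratfun" where
  "delta_loop = lin (\<lambda>c. if c = class_of (uniform 0 1) then 1 else 0)"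

text \<open>The linear map inside is \<open>m \<circ> (f \<otimes> g)\<close>, determined by \<open>c \<otimes> d \<mapsto> f(c) g(d)\<close>.\<close>

definition conv :: "('k::field matroid_hopf \<Rightarrow> 'k ratfun) \<Rightarrow> ('k matroid_hopf \<Rightarrow> 'k ratfun)
    \<Rightarrow> 'k matroid_hopf \<Rightarrow> 'k ratfun" (infixl \<open>\<star>\<close> 70) where
  "f \<star> g = lin (\<lambda>(c, d). f (Poly_Mapping.single c 1) * g (Poly_Mapping.single d 1)) \<circ> coproduct"

primrec conv_power :: "('k::field matroid_hopf \<Rightarrow> 'k ratfun) \<Rightarrow> nat
    \<Rightarrow> 'k matroid_hopf \<Rightarrow> 'k ratfun" where
  "conv_power f 0 = counit"
| "conv_power f (Suc n) = conv_power f n \<star> f"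

text \<open>\<open>\<Sum>k.\<close> without bounds is the sum over the support, which is finite at each matroid
  if \<open>f\<close> vanishes on the empty matroid; see \<open>exp_conv_locally_finite\<close> below.\<close>

definition exp_conv :: "('k::field_char_0 matroid_hopf \<Rightarrow> 'k ratfun)
    \<Rightarrow> 'k matroid_hopf \<Rightarrow> 'k ratfun" where
  "exp_conv f h = (\<Sum>k. const (1 / fact k) * conv_power f k h)"

definition alpha :: "'k::field_char_0 ratfun \<Rightarrow> 'k ratfun \<Rightarrow> 'k ratfun \<Rightarrow> 'k ratfun
    \<Rightarrow> 'k matroid_hopf \<Rightarrow> 'k ratfun" where
  "alpha x1 x2 y1 y2 =
     exp_conv (\<lambda>h. x1 * delta_coloop h + x2 * delta_loop h) \<star>
     exp_conv (\<lambda>h. y1 * delta_coloop h + y2 * delta_loop h)"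

definition tutte :: "'e matroid \<Rightarrow> 'a::comm_ring_1 \<Rightarrow> 'a \<Rightarrow> 'a" where
  "tutte M x y = (\<Sum>A\<in>Pow (ground M).
     (x - 1) ^ (rank M (ground M) - rank M A) * (y - 1) ^ (card A - rank M A))"

lemma const_0 [simp]: "const 0 = 0" and const_1 [simp]: "const 1 = 1"
  and const_add: "const (a + b) = const a + const b"
proof -
  show "const 0 = 0" "const 1 = 1"
    by (simp_all add: const_def flip: one_pCons)
  show "const (a + b) = const a + const b"
    unfolding const_def to_fract_add[symmetric] by simp
qed

lemma lin_single [simp]: "lin \<phi> (Poly_Mapping.single b 1) = \<phi> b"
  by (simp add: lin_def lin_ext_def)

lemma counit_matroid_elem: "counit (matroid_elem M) = (if ground M = {} then 1 else 0)"
proof -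
  have "ground (rep_matroid_class (class_of M)) = {} \<longleftrightarrow> ground M = {}"
    using rep_class_of[of M] unfolding matroid_iso_def by (auto simp: bij_betw_def)
  then show ?thesis by (simp add: counit_def matroid_elem_def)
qed

lemma delta_coloop_matroid_elem:
  "delta_coloop (matroid_elem M) = (if M \<cong>\<^sub>M uniform 1 1 then 1 else 0)"
  by (simp add: delta_coloop_def matroid_elem_def class_of_eq_iff)

lemma delta_loop_matroid_elem:
  "delta_loop (matroid_elem M) = (if M \<cong>\<^sub>M uniform 0 1 then 1 else 0)"
  by (simp add: delta_loop_def matroid_elem_def class_of_eq_iff)

lemma lin_add: "lin \<phi> (h + h') = lin \<phi> h + lin \<phi> h'"
proof -
  let ?K = "Poly_Mapping.keys h \<union> Poly_Mapping.keys h'"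
  have *: "lin \<phi> g = (\<Sum>b\<in>?K. const (Poly_Mapping.lookup g b) * \<phi> b)"
    if "Poly_Mapping.keys g \<subseteq> ?K" for g
    unfolding lin_def lin_ext_def
    by (rule sum.mono_neutral_left) (use that in \<open>auto simp: in_keys_iff\<close>)
  show ?thesis
    using *[of h] *[of h'] *[of "h + h'"] Poly_Mapping.keys_add[of h h']
    by (simp add: lookup_add const_add distrib_right sum.distrib)
qed

lemma lin_sum: "lin \<phi> (\<Sum>i\<in>S. h i) = (\<Sum>i\<in>S. lin \<phi> (h i))"
proof -
  have "lin \<phi> 0 = 0" by (simp add: lin_def lin_ext_def)
  then show ?thesis by (induction S rule: infinite_finite_induct) (simp_all add: lin_add)
qed

lemma conv_matroid_elem:
  "(f \<star> g) (matroid_elem M) = (\<Sum>A\<in>Pow (ground M).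
     f (matroid_elem (delete M (ground M - A))) * g (matroid_elem (contract M A)))"
  unfolding conv_def o_apply coproduct_matroid_elem coproduct_matroid_def lin_sum
  by (simp add: matroid_elem_def)

lemma conv_power_eq_0:
  assumes "f (matroid_elem (uniform 0 0)) = 0" "card (ground M) < k"
  shows "conv_power f k (matroid_elem M) = 0"
  using assms(2)
proof (induction k arbitrary: M)
  case (Suc k)
  have "conv_power f k (matroid_elem (delete M (ground M - A))) *
      f (matroid_elem (contract M A)) = 0" if "A \<subseteq> ground M" for A
  proof (cases "A = ground M")
    case True
    have "contract M A \<cong>\<^sub>M uniform 0 0"
    proof -
      have "N \<cong>\<^sub>M uniform 0 0" if "ground N = {}" for N :: "'b matroid"
      proof -
        have "indeps N = {{}}" using indeps_subset_ground[of _ N] that empty_indeps[of N] by auto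
        then show ?thesis using that by (intro matroid_isoI[of "\<lambda>_. 0"]) auto
      qed
      then show ?thesis using True by simp
    qed
    then have "f (matroid_elem (contract M A)) = 0"
      using assms(1) by (simp add: matroid_elem_def class_of_eq_iff[symmetric])
    then show ?thesis by simp
  next
    case False
    then have "card A < card (ground M)" using that by (simp add: psubset_card_mono psubset_eq)
    moreover have "ground (delete M (ground M - A)) = A" using that by auto
    ultimately have "card (ground (delete M (ground M - A))) < k" using Suc.prems by simp
    then show ?thesis using Suc.IH by simp
  qed
  then show ?case
    unfolding conv_power.simps(2) conv_matroid_elem by (intro sum.neutral ballI) (simp only: Pow_iff)
qed simp

lemma exp_conv_locally_finite:
  assumes "f (matroid_elem (uniform 0 0)) = 0"
  shows "finite {k. const (1 / fact k) * conv_power f k (matroid_elem M) \<noteq> 0}"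
proof (rule finite_subset)
  show "{k. const (1 / fact k) * conv_power f k (matroid_elem M) \<noteq> 0} \<subseteq> {..card (ground M)}"
    using conv_power_eq_0[where f = f and M = M, OF assms] by (auto simp: not_le[symmetric])
qed simp

end

(*
  Let g(a, b) be the map sending M to a^r(M) b^(|E| - r(M)). Since rank and nullity are additive,
  g(a, b)(M|A) g(a, b)(M/A) = g(a, b)(M) for every A, and a delta_c + b delta_l is the restriction
  of g(a, b) to one-element matroids. Hence its k-th convolution power at M counts the |E|!
  maximal flags in E, each weighted by g(a, b)(M), if k = |E|, and vanishes otherwise; so
  exp_*(a delta_c + b delta_l) = g(a, b). The convolution of g(x1, x2) and g(y1, y2) is the
  corank-nullity expansion of the Tutte polynomial.
*)
theory Submission
  imports Defs
begin

section \<open>Ranks of minors\<close>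

lemma rank_eqI:
  assumes "B \<in> indeps M" "B \<subseteq> A" "\<And>X. X \<in> indeps M \<Longrightarrow> X \<subseteq> A \<Longrightarrow> card X \<le> card B"
  shows "rank M A = card B"
proof -
  have "finite (indeps M)"
    by (rule finite_subset[of _ "Pow (ground M)"]) (auto dest: indeps_subset_ground)
  then have "finite (card ` {I \<in> indeps M. I \<subseteq> A})" by simp
  moreover have "n \<le> card B" if "n \<in> card ` {I \<in> indeps M. I \<subseteq> A}" for n
    using that assms(3) by blast
  moreover have "card B \<in> card ` {I \<in> indeps M. I \<subseteq> A}"
    using assms(1,2) by blast
  ultimately show ?thesis
    unfolding rank_def by (rule Max_eqI)
qed

lemma rank_basis_of:
  assumes "basis_of (indeps M) A B"
  shows "rank M A = card B"
proof (rule rank_eqI)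
  show "B \<in> indeps M" "B \<subseteq> A" using assms by (auto simp: basis_of_def)
qed (rule basis_of_card_le[OF is_matroid_ground_indeps assms])

lemma basis_of_indeps_exists:
  obtains B where "basis_of (indeps M) A B" "B \<in> indeps M" "B \<subseteq> A" "finite B" "card B = rank M A"
proof -
  obtain B where B: "basis_of (indeps M) A B"
    using basis_of_exists[OF is_matroid_ground_indeps] by blast
  have "B \<in> indeps M" "B \<subseteq> A" using B by (auto simp: basis_of_def)
  then show ?thesis
    by (intro that[OF B]) (simp_all add: finite_indeps rank_basis_of[OF B])
qed

lemma card_le_rank:
  assumes "X \<in> indeps M" "X \<subseteq> A"
  shows "card X \<le> rank M A"
proof -
  obtain B where B: "basis_of (indeps M) A B" "card B = rank M A"
    by (rule basis_of_indeps_exists)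
  show ?thesis
    using basis_of_card_le[OF is_matroid_ground_indeps B(1) assms] B(2) by simp
qed

lemma rank_le_card:
  assumes "finite A"
  shows "rank M A \<le> card A"
proof -
  obtain B where "B \<subseteq> A" "card B = rank M A" by (rule basis_of_indeps_exists)
  then show ?thesis using card_mono[OF assms, of B] by simp
qed

lemma rank_mono:
  assumes "A \<subseteq> A'"
  shows "rank M A \<le> rank M A'"
proof -
  obtain B where "B \<in> indeps M" "B \<subseteq> A" "card B = rank M A" by (rule basis_of_indeps_exists)
  then show ?thesis using card_le_rank[of B M A'] assms by simp
qed

section \<open>Ranks of restrictions\<close>

lemma rank_restrict:
  assumes "A \<subseteq> ground M"
  shows "rank (delete M (ground M - A)) A = rank M A"
proof -
  have "ground M - (ground M - A) = A" using assms by blast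
  then have "{I \<in> indeps (delete M (ground M - A)). I \<subseteq> A} = {I \<in> indeps M. I \<subseteq> A}"
    by auto
  then show ?thesis by (simp add: rank_def)
qed

text \<open>A basis \<open>B\<close> of \<open>A\<close> extends to a basis \<open>Z\<close> of the
  whole matroid, and \<open>Z - B\<close> is then a largest independent set of the contraction. The
  additive form avoids truncated subtraction.\<close>

lemma rank_contract:
  assumes "A \<subseteq> ground M"
  shows "rank (contract M A) (ground M - A) + rank M A = rank M (ground M)"
proof -
  let ?E = "ground M" and ?I = "indeps M"
  obtain B where B: "basis_of ?I A B" "B \<in> ?I" "B \<subseteq> A" "finite B" "card B = rank M A"
    by (rule basis_of_indeps_exists)
  obtain C where C: "C \<in> ?I" "C \<subseteq> ?E" "card C = rank M ?E"
    by (rule basis_of_indeps_exists)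
  have "card B \<le> card C"
    using B(5) C(3) rank_mono[OF assms, of M] by simp
  then obtain Z where Z: "Z \<in> ?I" "B \<subseteq> Z" "Z \<subseteq> B \<union> C" "card Z = card C"
    using matroid_extend[OF is_matroid_ground_indeps B(2) C(1)] by blast
  have "Z \<inter> A \<in> ?I" using indeps_mono[OF Z(1)] by blast
  moreover have "B \<subseteq> Z \<inter> A" "Z \<inter> A \<subseteq> A" using B(3) Z(2) by auto
  \<comment> \<open>Maximality of \<open>B\<close> inside \<open>A\<close> forces every element
    added to \<open>B\<close> to lie outside \<open>A\<close>.\<close>
  ultimately have "Z \<inter> A = B" using B(1) unfolding basis_of_def by metis
  then have sub: "Z - B \<subseteq> ?E - A" using indeps_subset_ground[OF Z(1)] by blast
  have "(Z - B) \<union> B = Z" using Z(2) by blast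
  then have in_contract: "Z - B \<in> indeps (contract M A)"
    unfolding indeps_contract using sub B(1) Z(1) by (intro CollectI conjI exI[of _ B]) simp_all
  have card_diff: "card (Z - B) + card B = rank M ?E"
    using Z(4) C(3) card_Diff_subset[OF B(4) Z(2)] card_mono[OF finite_indeps[OF Z(1)] Z(2)]
    by linarith
  have "rank (contract M A) (?E - A) = card (Z - B)"
  proof (rule rank_eqI[OF in_contract sub])
    fix X assume "X \<in> indeps (contract M A)" "X \<subseteq> ?E - A"
    then obtain B' where X: "X \<subseteq> ?E - A" "basis_of ?I A B'" "X \<union> B' \<in> ?I"
      unfolding indeps_contract by blast
    have "card (X \<union> B') \<le> rank M ?E"
      by (rule card_le_rank[OF X(3) indeps_subset_ground[OF X(3)]])
    moreover have "card (X \<union> B') = card X + card B'"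
    proof (rule card_Un_disjoint)
      show "X \<inter> B' = {}" using X(1,2) unfolding basis_of_def by blast
    qed (use finite_indeps[OF X(3)] in simp_all)
    \<comment> \<open>The basis witnessing independence of \<open>X\<close> may differ from
      \<open>B\<close>, but all bases of \<open>A\<close> have the same size.\<close>
    moreover have "card B' = card B" using rank_basis_of[OF X(2)] B(5) by simp
    ultimately show "card X \<le> card (Z - B)" using card_diff by linarith
  qed
  then show ?thesis using card_diff B(5) by simp
qed

section \<open>Isomorphism invariants and one-element matroids\<close>

lemma matroid_iso_card_ground:
  assumes "M \<cong>\<^sub>M N"
  shows "card (ground M) = card (ground N)"
  using assms unfolding matroid_iso_def by (meson bij_betw_same_card)

lemma matroid_iso_rank_le:
  assumes "M \<cong>\<^sub>M N"
  shows "rank M (ground M) \<le> rank N (ground N)"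
proof -
  obtain f where f: "bij_betw f (ground M) (ground N)"
    "\<And>X. X \<subseteq> ground M \<Longrightarrow> X \<in> indeps M \<longleftrightarrow> f ` X \<in> indeps N"
    using assms unfolding matroid_iso_def by blast
  obtain B where B: "B \<in> indeps M" "B \<subseteq> ground M" "card B = rank M (ground M)"
    by (rule basis_of_indeps_exists)
  have "f ` B \<in> indeps N" using f(2) B by blast
  moreover have "card (f ` B) = card B"
    using f(1) B(2) by (meson bij_betw_def card_image inj_on_subset)
  ultimately show ?thesis
    using card_le_rank[of "f ` B" N "ground N"] indeps_subset_ground[of "f ` B" N] B(3) by simp
qed

lemma matroid_iso_rank: "M \<cong>\<^sub>M N \<Longrightarrow> rank M (ground M) = rank N (ground N)"
  by (rule antisym[OF matroid_iso_rank_le matroid_iso_rank_le[OF matroid_iso_sym]])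

lemma rank_uniform:
  assumes "r \<le> n"
  shows "rank (uniform r n) {..<n} = r"
proof -
  have "rank (uniform r n) {..<n} = card {..<r}"
    by (rule rank_eqI) (use assms in auto)
  then show ?thesis by simp
qed

text \<open>On a one-element ground set the rank decides whether the singleton is independent, hence
  determines the matroid. This turns the isomorphism tests in \<open>delta_coloop\<close> and
  \<open>delta_loop\<close> into numerical conditions.\<close>

lemma matroid_iso_uniform_1_iff:
  assumes "r \<le> 1"
  shows "M \<cong>\<^sub>M uniform r 1 \<longleftrightarrow> card (ground M) = 1 \<and> rank M (ground M) = r"
proof
  assume "M \<cong>\<^sub>M uniform r 1"
  then show "card (ground M) = 1 \<and> rank M (ground M) = r"
    using matroid_iso_card_ground[of M "uniform r 1"] matroid_iso_rank[of M "uniform r 1"]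
      rank_uniform[OF assms] by simp
next
  assume *: "card (ground M) = 1 \<and> rank M (ground M) = r"
  then obtain e where e: "ground M = {e}" by (auto simp: card_1_singleton_iff)
  obtain B where "B \<in> indeps M" "B \<subseteq> {e}" "card B = rank M {e}"
    by (rule basis_of_indeps_exists)
  then have B: "B \<in> indeps M" "B \<subseteq> {e}" "card B = r" using * e by simp_all
  have "X \<in> indeps M \<longleftrightarrow> X \<subseteq> {e} \<and> card X \<le> r" for X
  proof
    assume "X \<in> indeps M"
    then show "X \<subseteq> {e} \<and> card X \<le> r"
      using indeps_subset_ground[of X M] card_le_rank[of X M "ground M"] * e by simp
  next
    assume X: "X \<subseteq> {e} \<and> card X \<le> r"
    \<comment> \<open>Either \<open>X\<close> is empty, or \<open>X = {e}\<close>; in the latter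
      case \<open>r = 1\<close> and so \<open>B = {e}\<close>.\<close>
    then have "X \<subseteq> B" using B by (auto simp: subset_singleton_iff)
    then show "X \<in> indeps M" using B(1) indeps_mono by blast
  qed
  \<comment> \<open>The constant map to 0 is a bijection from \<open>{e}\<close> onto the ground set
    \<open>{0}\<close> of \<open>uniform r 1\<close>.\<close>
  then have "X \<in> indeps M \<longleftrightarrow> (\<lambda>_. 0) ` X \<in> indeps (uniform r 1)" if "X \<subseteq> {e}" for X
    using that by (auto simp: subset_singleton_iff)
  then show "M \<cong>\<^sub>M uniform r 1"
    unfolding matroid_iso_def e by (intro exI[of _ "\<lambda>_. 0"]) (auto simp: bij_betw_def)
qed

section \<open>The convolution exponential\<close>

text \<open>The two exponents are rank and nullity; the subtraction is never truncated, because the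
  rank is at most the size of the ground set.\<close>

definition rank_nullity_monomial :: "'a::comm_ring_1 \<Rightarrow> 'a \<Rightarrow> 'e matroid \<Rightarrow> 'a" where
  "rank_nullity_monomial a b M =
     a ^ rank M (ground M) * b ^ (card (ground M) - rank M (ground M))"

text \<open>Everything is expressed by ranks and nullities in \<open>M\<close>, so that sums over
  \<open>A\<close> can be compared termwise. The third claim keeps the nested subtraction in the
  second exact.\<close>

lemma rank_nullity_monomial_minors:
  assumes "A \<subseteq> ground M"
  shows "rank_nullity_monomial a b (delete M (ground M - A)) =
      a ^ rank M A * b ^ (card A - rank M A)"
    and "rank_nullity_monomial a b (contract M A) =
      a ^ (rank M (ground M) - rank M A) *
      b ^ ((card (ground M) - rank M (ground M)) - (card A - rank M A))"
    and "card A - rank M A \<le> card (ground M) - rank M (ground M)"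
proof -
  have fin: "finite A" using assms by (rule finite_subset) simp
  have "ground M - (ground M - A) = A" using assms by blast
  then show "rank_nullity_monomial a b (delete M (ground M - A)) =
      a ^ rank M A * b ^ (card A - rank M A)"
    using rank_restrict[OF assms] by (simp add: rank_nullity_monomial_def)
  \<comment> \<open>Nonnegative nullity of the contraction is what makes nullity grow from
    \<open>A\<close> to the ground set.\<close>
  have "rank (contract M A) (ground M - A) \<le> card (ground M - A)"
    by (rule rank_le_card) simp
  moreover have "card (ground M - A) = card (ground M) - card A" "card A \<le> card (ground M)"
    using assms fin by (simp_all add: card_Diff_subset card_mono)
  ultimately have r: "rank (contract M A) (ground M - A) = rank M (ground M) - rank M A"
    and n: "card (ground M - A) - (rank M (ground M) - rank M A) =
      (card (ground M) - rank M (ground M)) - (card A - rank M A)"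
    and le: "card A - rank M A \<le> card (ground M) - rank M (ground M)"
    using rank_contract[OF assms] rank_le_card[OF fin, of M] by linarith+
  show "card A - rank M A \<le> card (ground M) - rank M (ground M)" by (fact le)
  show "rank_nullity_monomial a b (contract M A) =
      a ^ (rank M (ground M) - rank M A) *
      b ^ ((card (ground M) - rank M (ground M)) - (card A - rank M A))"
    by (simp add: rank_nullity_monomial_def r n)
qed

lemma power_split:
  fixes x :: "'a::monoid_mult"
  shows "m \<le> n \<Longrightarrow> x ^ n = x ^ m * x ^ (n - m)"
  by (simp flip: power_add)

lemma rank_nullity_monomial_mult:
  assumes "A \<subseteq> ground M"
  shows "rank_nullity_monomial a b (delete M (ground M - A)) *
    rank_nullity_monomial a b (contract M A) = rank_nullity_monomial a b M"
proof -
  let ?n = "card (ground M) - rank M (ground M)" and ?m = "card A - rank M A"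
  have "a ^ rank M (ground M) = a ^ rank M A * a ^ (rank M (ground M) - rank M A)"
    by (rule power_split[OF rank_mono[OF assms]])
  moreover have "b ^ ?n = b ^ ?m * b ^ (?n - ?m)"
    by (rule power_split[OF rank_nullity_monomial_minors(3)[OF assms]])
  ultimately show ?thesis
    unfolding rank_nullity_monomial_minors(1,2)[OF assms]
    by (simp add: rank_nullity_monomial_def mult_ac)
qed

text \<open>A one-element matroid is a coloop (rank 1, monomial \<open>a\<close>) or a loop (rank 0,
  monomial \<open>b\<close>).\<close>

lemma delta_combination_matroid_elem:
  "a * delta_coloop (matroid_elem M) + b * delta_loop (matroid_elem M) =
    (if card (ground M) = 1 then rank_nullity_monomial a b M else 0)"
proof -
  note delta = delta_coloop_matroid_elem delta_loop_matroid_elem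
    matroid_iso_uniform_1_iff[OF order_refl] matroid_iso_uniform_1_iff[OF zero_le_one]
  show ?thesis
  proof (cases "card (ground M) = 1")
    case True
    then have "rank M (ground M) = 0 \<or> rank M (ground M) = 1"
      using rank_le_card[OF finite_ground, of M M] by linarith
    then show ?thesis
      unfolding delta using True by (auto simp: rank_nullity_monomial_def)
  next
    case False
    then show ?thesis unfolding delta by simp
  qed
qed

text \<open>The last convolution factor sees only contractions to one element. So \<open>A\<close>
  omits exactly one of the \<open>Suc k\<close> elements, and each choice contributes
  \<open>fact k\<close> copies of the monomial by induction.\<close>

lemma conv_power_delta_combination:
  "conv_power (\<lambda>h. a * delta_coloop h + b * delta_loop h) k (matroid_elem M) =
    (if card (ground M) = k then of_nat (fact k) * rank_nullity_monomial a b M else 0)"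
proof (induction k arbitrary: M)
  case 0
  have "rank M {} = 0" using rank_le_card[of "{}" M] by simp
  then show ?case by (auto simp: counit_matroid_elem rank_nullity_monomial_def)
next
  case (Suc k)
  let ?f = "\<lambda>h. a * delta_coloop h + b * delta_loop h"
  let ?S = "{A. A \<subseteq> ground M \<and> card A = k}"
  \<comment> \<open>By \<open>rank_nullity_monomial_mult\<close> the value of a nonzero summand does
    not depend on \<open>A\<close>, so it remains to count the admissible \<open>A\<close>.\<close>
  have summand: "conv_power ?f k (matroid_elem (delete M (ground M - A))) *
      ?f (matroid_elem (contract M A)) =
      (if card A = k \<and> card (ground M) = Suc k then of_nat (fact k) * rank_nullity_monomial a b M else 0)"
    if A: "A \<in> Pow (ground M)" for A
  proof -
    have A': "A \<subseteq> ground M" using A by simp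
    then have dbl: "ground M - (ground M - A) = A" by blast
    have fin: "finite A" using A' by (rule finite_subset) simp
    have "card (ground M - A) = card (ground M) - card A" "card A \<le> card (ground M)"
      using A' fin by (simp_all add: card_Diff_subset card_mono)
    then have "card A = k \<and> card (ground M - A) = 1 \<longleftrightarrow> card A = k \<and> card (ground M) = Suc k"
      by auto
    then show ?thesis
      unfolding Suc.IH delta_combination_matroid_elem
        rank_nullity_monomial_mult[OF A', of a b, symmetric]
      by (auto simp: dbl)
  qed
  have "conv_power ?f (Suc k) (matroid_elem M) = (\<Sum>A\<in>Pow (ground M).
      if card A = k \<and> card (ground M) = Suc k then of_nat (fact k) * rank_nullity_monomial a b M else 0)"
    unfolding conv_power.simps(2) conv_matroid_elem by (rule sum.cong[OF refl summand])
  also have "\<dots> = (if card (ground M) = Suc k then of_nat (fact (Suc k)) * rank_nullity_monomial a b M else 0)"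
  proof (cases "card (ground M) = Suc k")
    case True
    have "(\<Sum>A\<in>Pow (ground M). if card A = k then of_nat (fact k) * rank_nullity_monomial a b M else 0) =
        (\<Sum>A\<in>?S. of_nat (fact k) * rank_nullity_monomial a b M)"
      by (rule sum.mono_neutral_cong_right) auto
    also have "\<dots> = of_nat (card ?S) * (of_nat (fact k) * rank_nullity_monomial a b M)"
      by simp
    \<comment> \<open>The binomial coefficient \<open>Suc k choose k\<close>.\<close>
    also have "card ?S = Suc k"
      using n_subsets[of "ground M" k] True by simp
    finally show ?thesis using True by (simp add: algebra_simps)
  qed simp
  finally show ?case .
qed

section \<open>Cancelling the factorials in the exponential\<close>

lemma const_of_nat_mult: "const (of_nat n * c) = of_nat n * const c"
  by (induction n) (simp_all add: const_add algebra_simps)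

lemma const_inverse_fact: "const (1 / fact k :: 'k::field_char_0) * of_nat (fact k) = 1"
proof -
  have "const (1 / fact k :: 'k) * of_nat (fact k) = const (of_nat (fact k) * (1 / fact k))"
    unfolding const_of_nat_mult by (simp add: mult.commute)
  then show ?thesis by simp
qed

text \<open>Only the term with \<open>k = card (ground M)\<close> survives, and there
  \<open>1 / fact k\<close> cancels the number of maximal flags.\<close>

lemma exp_conv_delta_combination:
  "exp_conv (\<lambda>h. a * delta_coloop h + b * delta_loop h) (matroid_elem M) =
    rank_nullity_monomial a b M"
proof -
  let ?n = "card (ground M)"
  have "exp_conv (\<lambda>h. a * delta_coloop h + b * delta_loop h) (matroid_elem M) =
      (\<Sum>k. if k = ?n then const (1 / fact ?n) * (of_nat (fact ?n) * rank_nullity_monomial a b M) else 0)"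
    unfolding exp_conv_def conv_power_delta_combination by (rule Sum_any.cong) auto
  also have "\<dots> = const (1 / fact ?n) * of_nat (fact ?n) * rank_nullity_monomial a b M"
    by (simp add: mult.assoc)
  finally show ?thesis by (simp add: const_inverse_fact)
qed

section \<open>The Tutte polynomial\<close>

text \<open>The summands agree for each \<open>A\<close>: splitting the powers of \<open>x1\<close>
  and \<open>y2\<close> at the rank and nullity of \<open>A\<close> leaves just the factors that
  clear the denominators of \<open>y1 / x1\<close> and \<open>x2 / y2\<close>.\<close>

lemma conv_rank_nullity_monomial:
  fixes x1 x2 y1 y2 :: "'a::field"
  assumes "x1 \<noteq> 0" "y2 \<noteq> 0"
  shows "(\<Sum>A\<in>Pow (ground M). rank_nullity_monomial x1 x2 (delete M (ground M - A)) *
      rank_nullity_monomial y1 y2 (contract M A)) =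
    rank_nullity_monomial x1 y2 M * tutte M (y1 / x1 + 1) (x2 / y2 + 1)"
  unfolding tutte_def sum_distrib_left
proof (rule sum.cong[OF refl])
  fix A assume "A \<in> Pow (ground M)"
  then have A: "A \<subseteq> ground M" by simp
  let ?r = "rank M (ground M)" and ?n = "card (ground M) - rank M (ground M)"
  let ?s = "rank M A" and ?m = "card A - rank M A"
  have "x1 ^ ?r = x1 ^ ?s * x1 ^ (?r - ?s)"
    by (rule power_split[OF rank_mono[OF A]])
  moreover have "y2 ^ ?n = y2 ^ ?m * y2 ^ (?n - ?m)"
    by (rule power_split[OF rank_nullity_monomial_minors(3)[OF A]])
  ultimately show "rank_nullity_monomial x1 x2 (delete M (ground M - A)) *
      rank_nullity_monomial y1 y2 (contract M A) =
    rank_nullity_monomial x1 y2 M *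
      ((y1 / x1 + 1 - 1) ^ (?r - ?s) * (x2 / y2 + 1 - 1) ^ ?m)"
    unfolding rank_nullity_monomial_minors(1,2)[OF A]
    unfolding rank_nullity_monomial_def
    using assms by (simp add: power_divide)
qed

theorem theorem3p3:
  fixes M :: "'e matroid"
  shows "alpha X1 X2 Y1 Y2 (matroid_elem M :: 'k::field_char_0 matroid_hopf) =
    X1 ^ rank M (ground M) * Y2 ^ (card (ground M) - rank M (ground M)) *
    tutte M (Y1 / X1 + 1) (X2 / Y2 + 1)"
proof -
  \<comment> \<open>These are the denominators in the arguments of the Tutte polynomial.\<close>
  have "(X1 :: 'k ratfun) \<noteq> 0" "(Y2 :: 'k ratfun) \<noteq> 0"
    by (simp_all add: X1_def Y2_def)
  note conv = conv_rank_nullity_monomial[OF this]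
  show ?thesis
    unfolding alpha_def conv_matroid_elem exp_conv_delta_combination conv
    by (simp only: rank_nullity_monomial_def)
qed

end
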